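(* Let $k$ be a field with $\operatorname{char}k\neq2$. A smooth quadric hypersurface $Q^4\subset\mathbb{P}^5$ over $k$ contains a Veronese surface (defined over $k$) if and only if, in suitable linear coordinates, its equation can be written as $$Q^4_{a,b}=\bigl(x_0x_5=x_1^2+ax_2^2+bx_3^2+abx_4^2\bigr)$$ for some $a,b\in k^*$. Up to coordinate changes by $\mathrm{Aut}(\mathbb{P}^2)\times\mathrm{Aut}(Q^4_{a,b})$, the quadric $Q^4_{a,b}$ contains a unique Veronese surface; a representative is the image of $$(u:v:w)\mapsto\bigl(u^2+aw^2:\ uv:\ vw:\ uw:\ w^2:\ v^2+bw^2\bigr).$$
   Context: A Veronese surface in $\mathbb{P}^5$ is the image of $\mathbb{P}^2\to\mathbb{P}^5$, $(u:v:w)\mapsto(u^2:v^2:w^2:uv:vw:uw)$, composed with an automorphism of $\mathbb{P}^5$. *)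

theory Defs
  imports "HOL-Analysis.Analysis" "HOL-Computational_Algebra.Polynomial"
begin

text \<open>Polynomial ring k[u,v,w], realised as nested univariate polynomials
  ('a poly poly poly): u is the innermost variable, w the outermost.\<close>

type_synonym 'a tripoly = "'a poly poly poly"

definition Cst :: "'a::field \<Rightarrow> 'a tripoly" where
  "Cst c = [:[:[:c:]:]:]"

definition varU :: "'a::field tripoly" where "varU = [:[:[:0, 1:]:]:]"
definition varV :: "'a::field tripoly" where "varV = [:[:0, 1:]:]"
definition varW :: "'a::field tripoly" where "varW = [:0, 1:]"

definition lin_app :: "'a::field ^'n^'m \<Rightarrow> 'a tripoly ^'n \<Rightarrow> 'a tripoly ^'m" where
  "lin_app M x = (\<chi> i. \<Sum>j\<in>UNIV. Cst (M $ i $ j) * x $ j)"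

definition qform :: "'a::field ^'n^'n \<Rightarrow> 'a tripoly ^'n \<Rightarrow> 'a tripoly" where
  "qform A x = (\<Sum>i\<in>UNIV. \<Sum>j\<in>UNIV. Cst (A $ i $ j) * x $ i * x $ j)"

definition ver :: "'a::field tripoly \<Rightarrow> 'a tripoly \<Rightarrow> 'a tripoly \<Rightarrow> 'a tripoly ^ 6" where
  "ver x y z = (\<chi> i. if i = 0 then x^2 else if i = 1 then y^2 else if i = 2 then z^2
                   else if i = 3 then x * y else if i = 4 then y * z else x * z)"

definition ver0 :: "'a::field tripoly ^ 6" where
  "ver0 = ver varU varV varW"

definition uvw :: "'a::field tripoly ^ 3" where
  "uvw = (\<chi> i. if i = 0 then varU else if i = 1 then varV else varW)"

definition ver_h :: "'a::field ^3^3 \<Rightarrow> 'a tripoly ^ 6" where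
  "ver_h h = (let p = lin_app h uvw in ver (p $ 0) (p $ 1) (p $ 2))"

text \<open>Symmetric matrix of the quadric Q_{a,b}: x0 x5 - x1^2 - a x2^2 - b x3^2 - ab x4^2.\<close>
definition qab_mat :: "'a::field \<Rightarrow> 'a \<Rightarrow> 'a ^6^6" where
  "qab_mat a b = (\<chi> i j.
     if (i = 0 \<and> j = 5) \<or> (i = 5 \<and> j = 0) then 1/2
     else if i = j \<and> i = 1 then -1
     else if i = j \<and> i = 2 then -a
     else if i = j \<and> i = 3 then -b
     else if i = j \<and> i = 4 then -(a*b)
     else 0)"

definition rep_ver :: "'a::field \<Rightarrow> 'a \<Rightarrow> 'a tripoly ^ 6" where
  "rep_ver a b = (\<chi> i. if i = 0 then varU^2 + Cst a * varW^2
                   else if i = 1 then varU * varV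
                   else if i = 2 then varV * varW
                   else if i = 3 then varU * varW
                   else if i = 4 then varW^2
                   else varV^2 + Cst b * varW^2)"

end

theory Submission
  imports Defs
begin

text \<open>Identify the points of the 6-space with symmetric matrices \<open>X\<close>, the Veronese surface being the locus of
  rank one. The quadrics through it are \<open>tr (S cof X)\<close> for symmetric \<open>S\<close>, and \<open>X \<mapsto> h X h\<^sup>T\<close> replaces \<open>S\<close> by
  \<open>(cof h)\<^sup>T S (cof h)\<close>. Diagonalising \<open>S\<close> and scaling it to \<open>\<langle>a, b, 1\<rangle>\<close> gives the normal form. For uniqueness, the
  quadric of \<open>\<langle>a, b, 1\<rangle>\<close> is a hyperbolic plane minus the quaternion norm form \<open>\<langle>1, a, b, ab\<rangle>\<close>; if two such quadrics
  are similar, Witt cancellation and multiplicativity of the norm show that the pure quaternion forms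
  \<open>\<langle>a, b, ab\<rangle>\<close>, and hence the forms \<open>\<langle>a, b, 1\<rangle>\<close>, are similar as well.\<close>

section \<open>Enumeration of the index types \<open>3\<close> and \<open>6\<close> from 0\<close>

lemma UNIV_3_from_0: "(UNIV :: 3 set) = {0, 1, 2}"
proof -
  \<comment> \<open>Numerals of type \<open>3\<close> are read modulo 3, so the last index of
    \<open>UNIV_3\<close> is 0.\<close>
  have "(3::3) = 0" by simp
  with UNIV_3 show ?thesis by auto
qed

lemma forall_3_from_0: "(\<forall>i::3. P i) \<longleftrightarrow> P 0 \<and> P 1 \<and> P 2"
  using UNIV_3_from_0 by (metis UNIV_I empty_iff insert_iff)

lemma sum_3_from_0: "sum f (UNIV :: 3 set) = f 0 + f 1 + f 2"
  unfolding UNIV_3_from_0 by (simp add: add.assoc)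

lemma UNIV_6_from_0: "(UNIV :: 6 set) = {0, 1, 2, 3, 4, 5}"
proof -
  have "card {0, 1, 2, 3, 4, 5 :: 6} = 6" by simp
  then show ?thesis by (intro card_subset_eq[symmetric]) auto
qed

lemma forall_6_from_0: "(\<forall>i::6. P i) \<longleftrightarrow> P 0 \<and> P 1 \<and> P 2 \<and> P 3 \<and> P 4 \<and> P 5"
  using UNIV_6_from_0 by (metis UNIV_I empty_iff insert_iff)

lemma sum_6_from_0: "sum f (UNIV :: 6 set) = f 0 + f 1 + f 2 + f 3 + f 4 + f 5"
  unfolding UNIV_6_from_0 by (simp add: add.assoc)

section \<open>Symmetric bilinear forms\<close>

text \<open>Set over commutative rings so that it serves both for scalars and for
  \<open>tripoly\<close> entries.\<close>

definition bil :: "'a::comm_ring_1^'n^'n \<Rightarrow> 'a^'n \<Rightarrow> 'a^'n \<Rightarrow> 'a" where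
  "bil A x y = (\<Sum>i\<in>UNIV. x $ i * (A *v y) $ i)"

lemma bil_add_left: "bil A (x + y) z = bil A x z + bil A y z"
  by (simp add: bil_def algebra_simps sum.distrib)

lemma bil_add_right: "bil A z (x + y) = bil A z x + bil A z y"
  by (simp add: bil_def algebra_simps sum.distrib matrix_vector_right_distrib)

lemma bil_scale_left: "bil A (c *s x) z = c * bil A x z"
  by (simp add: bil_def algebra_simps sum_distrib_left)

lemma bil_scale_right: "bil A z (c *s x) = c * bil A z x"
  by (simp add: bil_def matrix_vector_mult_def sum_distrib_left mult_ac)

lemma bil_diff_left: "bil A (x - y) z = bil A x z - bil A y z"
  by (simp add: bil_def algebra_simps sum_subtractf)

lemma bil_diff_right: "bil A z (x - y) = bil A z x - bil A z y"
  by (simp add: bil_def algebra_simps sum_subtractf matrix_vector_mult_diff_distrib)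

lemmas bil_linear = bil_add_left bil_add_right bil_scale_left bil_scale_right
  bil_diff_left bil_diff_right

lemma bil_transpose: "bil (transpose A) x y = bil A y x"
  unfolding bil_def matrix_vector_mult_def transpose_def
  by (simp add: sum_distrib_left, subst sum.swap, simp add: mult_ac)

lemma bil_sym: "transpose A = A \<Longrightarrow> bil A x y = bil A y x"
  using bil_transpose[of A x y] by simp

lemma bil_matrix_right: "bil A x (M *v y) = bil (A ** M) x y"
  by (simp add: bil_def matrix_vector_mul_assoc)

lemma bil_matrix_left: "bil A (M *v x) y = bil (transpose M ** A) x y"
proof -
  have "bil A (M *v x) y = bil (transpose A ** M) y x"
    by (simp add: bil_transpose flip: bil_matrix_right)
  also have "\<dots> = bil (transpose (transpose A ** M)) x y" by (simp add: bil_transpose)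
  finally show ?thesis by (simp add: matrix_transpose_mul)
qed

lemma bil_congruence:
  fixes A P :: "'a::comm_ring_1^'n^'n"
  shows "bil (transpose P ** A ** P) x y = bil A (P *v x) (P *v y)"
  by (simp add: bil_matrix_right bil_matrix_left matrix_mul_assoc)

lemma mat_vector_mult: "mat c *v x = c *s x"
  by (simp add: vec_eq_iff matrix_vector_mult_def mat_def if_distrib[of "\<lambda>z. z * _"] cong: if_cong)

lemma bil_mat_mult: "bil (mat c ** A) x y = c * bil A x y"
  by (simp add: bil_def mat_vector_mult sum_distrib_left mult_ac flip: matrix_vector_mul_assoc)

lemma bil_axis: "bil A (axis i 1) (axis j 1) = A $ i $ j"
  by (simp add: bil_def axis_def matrix_vector_mult_def if_distrib[of "\<lambda>z. z * _"]
      if_distrib[of "\<lambda>z. _ * z"] cong: if_cong)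

lemma bil_inject: "(\<And>x y. bil A x y = bil B x y) \<Longrightarrow> A = B"
  by (simp add: vec_eq_iff flip: bil_axis)

lemma mat_mult_mat: "mat c ** mat d = mat (c * d :: 'a::comm_ring_1)"
  by (rule bil_inject, unfold bil_mat_mult)
    (simp add: bil_def mat_vector_mult sum_distrib_left mult_ac)

lemma bil_polarize:
  fixes A :: "'a::field^'n^'n"
  assumes "(2::'a) \<noteq> 0" "transpose A = A"
  shows "bil A x y = (bil A (x + y) (x + y) - bil A x x - bil A y y) / 2"
  using assms by (simp add: bil_linear bil_sym[OF assms(2), of y x])

text \<open>Polarisation recovers the bilinear form. This turns pointwise identities of quadratic
  forms into the matrix congruences of the final statement.\<close>

lemma sym_eq_if_quadratic_eq:
  fixes A :: "'a::field^'n^'n"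
  assumes "(2::'a) \<noteq> 0" "transpose A = A" "transpose B = B" "\<And>x. bil A x x = bil B x x"
  shows "A = B"
proof (rule bil_inject)
  fix x y show "bil A x y = bil B x y"
    unfolding bil_polarize[OF assms(1,2), of x y] bil_polarize[OF assms(1,3), of x y]
    by (simp add: assms(4))
qed

lemma transpose_congruence:
  fixes A :: "'a::comm_ring_1^'n^'n"
  assumes "transpose A = A" shows "transpose (transpose P ** A ** P) = transpose P ** A ** P"
  by (simp add: matrix_transpose_mul assms matrix_mul_assoc)

lemma transpose_mat_mult:
  fixes A :: "'a::comm_ring_1^'n^'n"
  assumes "transpose A = A" shows "transpose (mat c ** A) = mat c ** A"
proof (rule bil_inject)
  fix x y show "bil (transpose (mat c ** A)) x y = bil (mat c ** A) x y"
    by (simp add: bil_transpose bil_mat_mult bil_sym[OF assms, of y x])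
qed

lemma invertible_iff_ker:
  fixes A :: "'a::field^'n^'n"
  shows "invertible A \<longleftrightarrow> (\<forall>x. A *v x = 0 \<longrightarrow> x = 0)"
  by (simp add: invertible_left_inverse matrix_left_invertible_ker)

lemma bil_nondegenerate:
  fixes A :: "'a::field^'n^'n"
  assumes "invertible A" "\<And>y. bil A y x = 0" shows "x = 0"
proof -
  have "(A *v x) $ i = 0" for i
    using assms(2)[of "axis i 1"] by (simp add: bil_def axis_def if_distrib[of "\<lambda>z. z * _"] cong: if_cong)
  then show ?thesis using assms(1) by (simp add: invertible_iff_ker vec_eq_iff)
qed

section \<open>Reflections\<close>

text \<open>With \<open>c = 2 / bil A v v\<close> the map is the reflection in the hyperplane
  orthogonal to \<open>v\<close>.\<close>

lemma reflection_matrix_exists: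
  fixes A :: "'a::field^'n^'n"
  obtains M where "\<And>x. M *v x = x - (c * bil A v x) *s v"
proof -
  have "Vector_Spaces.linear (*s) (*s) (\<lambda>x. x - (c * bil A v x) *s v)"
    by (rule Vector_Spaces.linear_iff[THEN iffD2])
      (auto simp: vec.vector_space_axioms bil_linear vec_eq_iff algebra_simps)
  then show ?thesis by (intro that) (rule matrix_works)
qed

lemma reflection_isometry:
  fixes A :: "'a::field^'n^'n"
  assumes "transpose A = A" "bil A v v \<noteq> 0"
  obtains M where "\<And>x. M *v x = x - (2 / bil A v v * bil A v x) *s v"
    and "\<And>x y. bil A (M *v x) (M *v y) = bil A x y"
proof -
  obtain M where M: "\<And>x. M *v x = x - (2 / bil A v v * bil A v x) *s v"
    using reflection_matrix_exists by blast
  have "bil A (M *v x) (M *v y) = bil A x y" for x y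
    using assms(2) by (simp add: M bil_linear bil_sym[OF assms(1), of x v] field_simps)
  with M that show ?thesis by blast
qed

text \<open>Either \<open>x - y\<close> or \<open>x + y\<close> is anisotropic, since \<open>q (x - y) + q (x + y) = 4 q x\<close>; in the first
  case its reflection maps \<open>x\<close> to \<open>y\<close>, in the second to \<open>- y\<close>.\<close>

lemma isometry_moving_vector:
  fixes A :: "'a::field^'n^'n"
  assumes two: "(2::'a) \<noteq> 0" and A: "transpose A = A"
    and eq: "bil A x x = bil A y y" and nz: "bil A x x \<noteq> 0"
  obtains M where "M *v x = y"
    and "\<And>u w. bil A (M *v u) (M *v w) = bil A u w"
    and "\<And>z. bil A x z = 0 \<Longrightarrow> bil A y z = 0 \<Longrightarrow> M *v z = z"
proof (cases "bil A (x - y) (x - y) = 0")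
  case False
  then obtain M where M: "\<And>z. M *v z = z - (2 / bil A (x - y) (x - y) * bil A (x - y) z) *s (x - y)"
    and iso: "\<And>u w. bil A (M *v u) (M *v w) = bil A u w"
    using reflection_isometry[OF A] by metis
  \<comment> \<open>As \<open>x\<close> and \<open>y\<close> have equal norm, the coefficient of the
    reflection at \<open>x\<close> is 1, so it subtracts exactly \<open>x - y\<close>.\<close>
  have "bil A (x - y) (x - y) = 2 * bil A (x - y) x"
    using eq by (simp add: bil_linear bil_sym[OF A, of y x])
  with False have "M *v x = y" by (simp add: M)
  moreover have "M *v z = z" if "bil A x z = 0" "bil A y z = 0" for z
    using that by (simp add: M bil_linear)
  ultimately show ?thesis using that iso by blast
next
  case True
  have "bil A (x - y) (x - y) + bil A (x + y) (x + y) = 2 * 2 * bil A x x"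
    using eq by (simp add: bil_linear)
  with True two nz have nz': "bil A (x + y) (x + y) \<noteq> 0" by (metis add_0 mult_eq_0_iff)
  then obtain M where M: "\<And>z. M *v z = z - (2 / bil A (x + y) (x + y) * bil A (x + y) z) *s (x + y)"
    and iso: "\<And>u w. bil A (M *v u) (M *v w) = bil A u w"
    using reflection_isometry[OF A] by metis
  have "bil A (x + y) (x + y) = 2 * bil A (x + y) x"
    using eq by (simp add: bil_linear bil_sym[OF A, of y x])
  with nz' have Mx: "M *v x = - y" by (simp add: M)
  have fixM: "M *v z = z" if "bil A x z = 0" "bil A y z = 0" for z
    using that by (simp add: M bil_linear)
  \<comment> \<open>The reflection in \<open>y\<close> corrects the sign and still fixes every
    vector orthogonal to \<open>y\<close>.\<close>
  obtain N where N: "\<And>z. N *v z = z - (2 / bil A y y * bil A y z) *s y"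
    and isoN: "\<And>u w. bil A (N *v u) (N *v w) = bil A u w"
    using reflection_isometry[OF A] eq nz by metis
  have "bil A y (- y) = - bil A y y" using bil_scale_right[of A y "-1" y] by simp
  then have "N *v (- y) = y" using eq nz by (simp add: N vec_eq_iff)
  then have "(N ** M) *v x = y" by (simp add: Mx flip: matrix_vector_mul_assoc)
  moreover have "bil A ((N ** M) *v u) ((N ** M) *v w) = bil A u w" for u w
    by (simp add: iso isoN flip: matrix_vector_mul_assoc)
  moreover have "(N ** M) *v z = z" if "bil A x z = 0" "bil A y z = 0" for z
    using that by (simp add: fixM N flip: matrix_vector_mul_assoc)
  ultimately show ?thesis using that by blast
qed

section \<open>Nested polynomials\<close>

lemma Cst_0 [simp]: "Cst 0 = 0" and Cst_1 [simp]: "Cst 1 = 1"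
  and Cst_add: "Cst (a + b) = Cst a + Cst b" and Cst_mult: "Cst (a * b) = Cst a * Cst b"
  and Cst_uminus: "Cst (- a) = - Cst a"
  by (simp_all add: Cst_def one_pCons)

lemma Cst_sum: "Cst (sum f A) = (\<Sum>i\<in>A. Cst (f i))"
  by (induction A rule: infinite_finite_induct) (simp_all add: Cst_add)

definition Cst_mat :: "'a::field^'n^'m \<Rightarrow> 'a tripoly^'n^'m" where
  "Cst_mat M = (\<chi> i j. Cst (M $ i $ j))"

lemma Cst_mat_mult: "Cst_mat (A ** B) = Cst_mat A ** Cst_mat B"
  by (simp add: Cst_mat_def matrix_matrix_mult_def Cst_sum Cst_mult vec_eq_iff)

lemma Cst_mat_transpose: "Cst_mat (transpose A) = transpose (Cst_mat A)"
  by (simp add: Cst_mat_def transpose_def vec_eq_iff)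

lemma Cst_mat_mat: "Cst_mat (mat c) = mat (Cst c)"
  by (simp add: Cst_mat_def mat_def vec_eq_iff)

lemma lin_app_eq: "lin_app M x = Cst_mat M *v x"
  by (simp add: lin_app_def Cst_mat_def matrix_vector_mult_def)

lemma qform_eq_bil: "qform A x = bil (Cst_mat A) x x"
  by (simp add: qform_def bil_def Cst_mat_def matrix_vector_mult_def sum_distrib_left mult_ac)

lemma lin_app_mult: "lin_app (A ** B) x = lin_app A (lin_app B x)"
  by (simp add: lin_app_eq Cst_mat_mult matrix_vector_mul_assoc)

lemma qform_lin_app:
  fixes A G :: "'a::field^'n^'n"
  shows "qform A (lin_app G x) = qform (transpose G ** A ** G) x"
  by (simp add: qform_eq_bil lin_app_eq Cst_mat_mult Cst_mat_transpose bil_congruence)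

lemma qform_mat_mult: "qform (mat c ** A) x = Cst c * qform A x"
  by (simp add: qform_eq_bil Cst_mat_mult Cst_mat_mat bil_mat_mult)

text \<open>The lists run over powers of w, then v, then u; the nonconstant pattern holds one entry
  for each of the fifteen quartic monomials.\<close>

lemma qform_ver0_expand:
  fixes B :: "'a::field^6^6"
  shows "qform B ver0 =
   [:[:[:0, 0, 0, 0, B$0$0:], [:0, 0, 0, B$0$3 + B$3$0:], [:0, 0, B$0$1 + B$1$0 + B$3$3:], [:0, B$1$3 + B$3$1:], [:B$1$1:]:],
     [:[:0, 0, 0, B$0$5 + B$5$0:], [:0, 0, B$0$4 + B$4$0 + B$3$5 + B$5$3:], [:0, B$1$5 + B$5$1 + B$3$4 + B$4$3:], [:B$1$4 + B$4$1:]:],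
     [:[:0, 0, B$0$2 + B$2$0 + B$5$5:], [:0, B$2$3 + B$3$2 + B$4$5 + B$5$4:], [:B$1$2 + B$2$1 + B$4$4:]:],
     [:[:0, B$2$5 + B$5$2:], [:B$2$4 + B$4$2:]:],
     [:[:B$2$2:]:]:]"
  unfolding qform_def sum_6_from_0 ver0_def ver_def Cst_def varU_def varV_def varW_def power2_eq_square
  by (simp add: ac_simps)

lemma qform_ver0_eq_0D:
  fixes B :: "'a::field^6^6"
  assumes "qform B ver0 = 0"
  shows "B$0$0 = 0" "B$1$1 = 0" "B$2$2 = 0"
    "B$0$1 + B$1$0 + B$3$3 = 0" "B$1$2 + B$2$1 + B$4$4 = 0" "B$0$2 + B$2$0 + B$5$5 = 0"
    "B$0$3 + B$3$0 = 0" "B$0$5 + B$5$0 = 0" "B$1$3 + B$3$1 = 0" "B$1$4 + B$4$1 = 0"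
    "B$2$4 + B$4$2 = 0" "B$2$5 + B$5$2 = 0"
    "B$0$4 + B$4$0 + B$3$5 + B$5$3 = 0" "B$1$5 + B$5$1 + B$3$4 + B$4$3 = 0"
    "B$2$3 + B$3$2 + B$4$5 + B$5$4 = 0"
  using assms
  by (simp_all add: qform_ver0_expand)

section \<open>Cofactor matrices\<close>

definition mat3 :: "'a \<Rightarrow> 'a \<Rightarrow> 'a \<Rightarrow> 'a \<Rightarrow> 'a \<Rightarrow> 'a \<Rightarrow> 'a \<Rightarrow> 'a \<Rightarrow> 'a \<Rightarrow> 'a^3^3" where
  "mat3 a b c d e f g h k = (\<chi> i j.
     if i = 0 then (if j = 0 then a else if j = 1 then b else c)
     else if i = 1 then (if j = 0 then d else if j = 1 then e else f)
     else (if j = 0 then g else if j = 1 then h else k))"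

lemma mat3_nth [simp]:
  "mat3 a b c d e f g h k $ 0 $ 0 = a" "mat3 a b c d e f g h k $ 0 $ 1 = b"
  "mat3 a b c d e f g h k $ 0 $ 2 = c" "mat3 a b c d e f g h k $ 1 $ 0 = d"
  "mat3 a b c d e f g h k $ 1 $ 1 = e" "mat3 a b c d e f g h k $ 1 $ 2 = f"
  "mat3 a b c d e f g h k $ 2 $ 0 = g" "mat3 a b c d e f g h k $ 2 $ 1 = h"
  "mat3 a b c d e f g h k $ 2 $ 2 = k"
  by (simp_all add: mat3_def)

abbreviation diag3 :: "'a::zero \<Rightarrow> 'a \<Rightarrow> 'a \<Rightarrow> 'a^3^3" where
  "diag3 p q r \<equiv> mat3 p 0 0 0 q 0 0 0 r"

lemma mat3_eq_iff:
  "(A :: 'a^3^3) = B \<longleftrightarrow> A$0$0 = B$0$0 \<and> A$0$1 = B$0$1 \<and> A$0$2 = B$0$2 \<and>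
     A$1$0 = B$1$0 \<and> A$1$1 = B$1$1 \<and> A$1$2 = B$1$2 \<and>
     A$2$0 = B$2$0 \<and> A$2$1 = B$2$1 \<and> A$2$2 = B$2$2"
  by (auto simp: vec_eq_iff forall_3_from_0)

lemma matrix_mult_3_nth:
  "((A :: 'a::semiring_1^3^'n) ** B) $ i $ j = A$i$0 * B$0$j + A$i$1 * B$1$j + A$i$2 * B$2$j"
  by (simp add: matrix_matrix_mult_def sum_3_from_0)

lemma transpose_nth: "transpose A $ i $ j = A $ j $ i"
  by (simp add: transpose_def)

text \<open>The signed cofactors without the transposition of the adjugate, so that products keep
  their order.\<close>

definition cof3 :: "'a::comm_ring_1^3^3 \<Rightarrow> 'a^3^3" where
  "cof3 M = mat3
     (M$1$1 * M$2$2 - M$1$2 * M$2$1) (M$1$2 * M$2$0 - M$1$0 * M$2$2) (M$1$0 * M$2$1 - M$1$1 * M$2$0)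
     (M$0$2 * M$2$1 - M$0$1 * M$2$2) (M$0$0 * M$2$2 - M$0$2 * M$2$0) (M$0$1 * M$2$0 - M$0$0 * M$2$1)
     (M$0$1 * M$1$2 - M$0$2 * M$1$1) (M$0$2 * M$1$0 - M$0$0 * M$1$2) (M$0$0 * M$1$1 - M$0$1 * M$1$0)"

lemma cof3_mult: "cof3 (A ** B) = cof3 A ** cof3 B"
  by (simp add: mat3_eq_iff cof3_def matrix_mult_3_nth algebra_simps)

lemma cof3_transpose: "cof3 (transpose A) = transpose (cof3 A)"
  by (simp add: mat3_eq_iff cof3_def transpose_nth algebra_simps)

lemma det3:
  "det (A :: 'a::comm_ring_1^3^3) = A$0$0 * cof3 A$0$0 + A$0$1 * cof3 A$0$1 + A$0$2 * cof3 A$0$2"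
proof -
  \<comment> \<open>With index 3 read as 0, \<open>det_3\<close> becomes the expansion along row
    0.\<close>
  have "(3::3) = 0" by simp
  then show ?thesis unfolding det_3 by (simp only:) (simp add: cof3_def algebra_simps)
qed

text \<open>Makes every \<open>k\<close>, up to the factor \<open>det k\<close>, a cofactor matrix,
  so that congruences of \<open>S\<close> by \<open>k\<close> lift to substitutions on the
  surface.\<close>

lemma cof3_cof3: "cof3 (cof3 A) = mat (det A) ** A"
  by (simp add: mat3_eq_iff det3 matrix_mult_3_nth mat_def) (simp add: cof3_def algebra_simps)

lemma transpose_mult_cof3: "transpose A ** cof3 A = mat (det A)"
  by (simp add: mat3_eq_iff det3 matrix_mult_3_nth mat_def transpose_nth) (simp add: cof3_def algebra_simps)

lemma invertible_cof3:
  fixes A :: "'a::field^3^3"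
  assumes "invertible A" shows "invertible (cof3 A)"
proof -
  have "mat (1 / det A) ** transpose A ** cof3 A = mat 1"
    using assms by (simp add: transpose_mult_cof3 mat_mult_mat invertible_det_nz flip: matrix_mul_assoc)
  then show ?thesis unfolding invertible_left_inverse by blast
qed

section \<open>Quadrics through the Veronese surface\<close>

text \<open>The entries follow the order of \<open>ver\<close>, whose values become rank one
  matrices.\<close>

definition sym_mat :: "'a^6 \<Rightarrow> 'a^3^3" where
  "sym_mat x = mat3 (x$0) (x$3) (x$5) (x$3) (x$1) (x$4) (x$5) (x$4) (x$2)"

lemma sym_mat_inject: "sym_mat x = sym_mat y \<longleftrightarrow> x = y"
  by (auto simp: sym_mat_def mat3_eq_iff vec_eq_iff forall_6_from_0)

lemma sym_mat_zero: "sym_mat 0 = (0 :: 'a::zero^3^3)"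
  by (simp add: sym_mat_def mat3_eq_iff)

text \<open>Coordinate \<open>i\<close> of the 6-space is the matrix entry in row \<open>pair_fst i\<close> and column \<open>pair_snd i\<close>.\<close>

definition pair_fst :: "6 \<Rightarrow> 3" where
  "pair_fst i = (if i = 1 \<or> i = 4 then 1 else if i = 2 then 2 else 0)"

definition pair_snd :: "6 \<Rightarrow> 3" where
  "pair_snd i = (if i = 0 then 0 else if i = 1 \<or> i = 3 then 1 else 2)"

text \<open>The symmetric square of \<open>h\<close>, that is \<open>X\<close> to
  \<open>h X h^T\<close> in the six coordinates. Off-diagonal entries occur twice in
  \<open>X\<close>, hence two summands for \<open>r\<close> distinct from \<open>s\<close>.\<close>

definition sym_square :: "'a::comm_ring_1^3^3 \<Rightarrow> 'a^6^6" where
  "sym_square h = (\<chi> i j. let p = pair_fst i; q = pair_snd i; r = pair_fst j; s = pair_snd j in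
     if r = s then h$p$r * h$q$r else h$p$r * h$q$s + h$p$s * h$q$r)"

lemma sym_eq_sym_mat: "transpose M = M \<Longrightarrow> sym_mat (\<chi> i. M $ pair_fst i $ pair_snd i) = M"
proof -
  assume "transpose M = M"
  then have "M $ i $ j = M $ j $ i" for i j by (metis transpose_nth)
  note this[of 1 0] this[of 2 0] this[of 2 1]
  then show ?thesis by (simp add: sym_mat_def mat3_eq_iff pair_fst_def pair_snd_def)
qed

lemma transpose_sym_mat: "transpose (sym_mat x) = sym_mat x"
  by (simp add: sym_mat_def mat3_eq_iff transpose_nth)

lemma sym_square_vector_nth:
  "(sym_square h *v x) $ i = (h ** sym_mat x ** transpose h) $ pair_fst i $ pair_snd i"
proof -
  have "(sym_square h *v x) $ i = (\<Sum>j\<in>UNIV. sym_square h $ i $ j * x $ j)"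
    by (simp add: matrix_vector_mult_def)
  also have "\<dots> = (h ** sym_mat x ** transpose h) $ pair_fst i $ pair_snd i"
    unfolding sum_6_from_0 matrix_mult_3_nth transpose_nth sym_mat_def mat3_nth sym_square_def Let_def vec_lambda_beta
    by (simp add: pair_fst_def[of 0] pair_snd_def[of 0] pair_fst_def[of 1] pair_snd_def[of 1]
      pair_fst_def[of 2] pair_snd_def[of 2] pair_fst_def[of 3] pair_snd_def[of 3]
      pair_fst_def[of 4] pair_snd_def[of 4] pair_fst_def[of 5] pair_snd_def[of 5] algebra_simps)
  finally show ?thesis .
qed

lemma sym_mat_sym_square:
  fixes h :: "'a::comm_ring_1^3^3"
  shows "sym_mat (sym_square h *v x) = h ** sym_mat x ** transpose h"
proof -
  have "transpose (h ** sym_mat x ** transpose h) = h ** sym_mat x ** transpose h"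
    by (simp add: matrix_transpose_mul transpose_sym_mat matrix_mul_assoc)
  moreover have "sym_square h *v x = (\<chi> i. (h ** sym_mat x ** transpose h) $ pair_fst i $ pair_snd i)"
    by (simp add: vec_eq_iff sym_square_vector_nth)
  ultimately show ?thesis by (simp add: sym_eq_sym_mat)
qed

lemma Cst_mat_sym_square: "Cst_mat (sym_square h) = sym_square (Cst_mat h)"
  by (simp add: vec_eq_iff Cst_mat_def sym_square_def Let_def Cst_add Cst_mult)

lemma sym_mat_ver: "sym_mat (ver (p$0) (p$1) (p$2)) = (\<chi> i j. p$i * p$j)"
  by (simp add: mat3_eq_iff sym_mat_def ver_def power2_eq_square mult.commute)

text \<open>For \<open>X = p p^T\<close> one has \<open>h X h^T = (h p) (h p)^T\<close>:
  reparametrising the plane by \<open>h\<close> is a linear map of the ambient space.\<close>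

lemma lin_app_sym_square:
  fixes h :: "'a::field^3^3"
  shows "lin_app (sym_square h) ver0 = ver_h h"
proof -
  let ?H = "Cst_mat h" and ?U = "\<chi> i j. uvw $ i * (uvw $ j :: 'a tripoly)"
  have "?H ** ?U ** transpose ?H = (\<chi> i j. (?H *v uvw) $ i * (?H *v uvw) $ j)"
    by (simp add: vec_eq_iff matrix_mult_3_nth transpose_nth matrix_vector_mult_def sum_3_from_0 algebra_simps)
  moreover have "sym_mat ver0 = ?U"
    using sym_mat_ver[of "uvw :: 'a tripoly^3"] by (simp add: ver0_def uvw_def)
  ultimately have "sym_mat (lin_app (sym_square h) ver0) = sym_mat (ver_h h)"
    by (simp add: lin_app_eq Cst_mat_sym_square sym_mat_sym_square sym_mat_ver ver_h_def Let_def)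
  then show ?thesis by (simp add: sym_mat_inject)
qed

lemma sym_square_mult:
  fixes g h :: "'a::comm_ring_1^3^3"
  shows "sym_square (g ** h) = sym_square g ** sym_square h"
proof -
  have "sym_square (g ** h) *v x = (sym_square g ** sym_square h) *v x" for x
    unfolding sym_mat_inject[symmetric] matrix_vector_mul_assoc[symmetric] sym_mat_sym_square
    by (simp add: matrix_transpose_mul matrix_mul_assoc)
  then show ?thesis using matrix_eq by blast
qed

lemma invertible_sym_square:
  fixes h :: "'a::field^3^3"
  assumes "invertible h" shows "invertible (sym_square h)"
  unfolding invertible_iff_ker
proof (intro allI impI)
  fix x assume "sym_square h *v x = 0"
  then have 0: "h ** sym_mat x ** transpose h = 0"
    using sym_mat_sym_square[of h x] by (simp add: sym_mat_zero)
  obtain g where g: "g ** h = mat 1" using assms invertible_left_inverse by blast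
  have "sym_mat x = g ** h ** sym_mat x ** transpose (g ** h)" by (simp add: g transpose_mat)
  also have "\<dots> = g ** (h ** sym_mat x ** transpose h) ** transpose g"
    by (simp add: matrix_transpose_mul matrix_mul_assoc)
  finally have "sym_mat x = 0" by (simp add: 0)
  then show "x = 0" by (metis sym_mat_inject sym_mat_zero)
qed

text \<open>A combination of the 2x2 minors of \<open>sym_mat x\<close> with coefficients from
  \<open>S\<close>; all of them vanish at rank one.\<close>

definition net_form :: "'a::comm_ring_1^3^3 \<Rightarrow> 'a^6 \<Rightarrow> 'a" where
  "net_form S x = trace (transpose S ** cof3 (sym_mat x))"

text \<open>Cofactors are multiplicative, and the trace is cyclic.\<close>

lemma net_form_sym_square:
  "net_form S (sym_square h *v x) = net_form (transpose (cof3 h) ** S ** cof3 h) x"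
proof -
  have "net_form S (sym_square h *v x) =
      trace ((transpose S ** cof3 h ** cof3 (sym_mat x)) ** transpose (cof3 h))"
    by (simp add: net_form_def sym_mat_sym_square cof3_mult cof3_transpose matrix_mul_assoc)
  also have "\<dots> = trace (transpose (cof3 h) ** (transpose S ** cof3 h ** cof3 (sym_mat x)))"
    by (rule trace_mul_sym)
  finally show ?thesis by (simp add: net_form_def matrix_transpose_mul matrix_mul_assoc)
qed

lemma net_form_mat_mult: "net_form (mat c ** S) x = c * net_form S x"
  by (simp add: net_form_def trace_def sum_3_from_0 matrix_mult_3_nth transpose_nth mat_def algebra_simps)

text \<open>The double cofactor matrix is \<open>det k\<close> times \<open>k\<close> and enters the
  congruence twice, hence the square.\<close>

lemma net_form_sym_square_cof3:
  assumes "transpose k ** S ** k = D"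
  shows "net_form S (sym_square (cof3 k) *v x) = (det k)\<^sup>2 * net_form D x"
proof -
  have "transpose (cof3 (cof3 k)) ** S ** cof3 (cof3 k) = mat ((det k)\<^sup>2) ** D"
    by (rule bil_inject)
      (simp add: cof3_cof3 bil_congruence bil_mat_mult bil_linear mat_vector_mult power2_eq_square
        flip: assms matrix_vector_mul_assoc)
  then show ?thesis by (simp add: net_form_sym_square net_form_mat_mult)
qed

text \<open>The fifteen coefficient relations leave six free entries of a symmetric
  \<open>B\<close>, which are those of \<open>S\<close> up to factors.\<close>

lemma net_form_if_qform_ver0:
  fixes B :: "'a::field^6^6"
  assumes "qform B ver0 = 0" "transpose B = B" "(2::'a) \<noteq> 0"
  obtains S where "transpose S = S" "\<And>x. bil B x x = net_form S x"
proof -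
  have sym: "B$i$j = B$j$i" for i j using assms(2) by (metis transpose_nth)
  note rels = qform_ver0_eq_0D[OF assms(1)]
  have opp: "B$i$j = - B$k$l" if "B$i$j + B$j$i + B$k$l + B$l$k = 0" for i j k l
  proof -
    have "2 * (B$i$j + B$k$l) = 0" using that sym[of j i] sym[of l k] by (simp add: algebra_simps)
    then show ?thesis using assms(3) by (metis eq_neg_iff_add_eq_0 mult_eq_0_iff)
  qed
  have zero: "B$i$j = 0" if "B$i$j + B$j$i = 0" for i j
    using that assms(3) sym[of j i] by (metis mult_2 mult_eq_0_iff)
  \<comment> \<open>Found by comparing coefficients. An off-diagonal cofactor occurs twice in the
    trace, so only the diagonal entries carry a factor 2.\<close>
  define S where "S = mat3 (2 * B$1$2) (- B$2$3) (- B$1$5) (- B$2$3) (2 * B$0$2)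
    (- B$0$4) (- B$1$5) (- B$0$4) (2 * B$0$1)"
  have diag: "B$3$3 = - 2 * B$0$1" "B$4$4 = - 2 * B$1$2" "B$5$5 = - 2 * B$0$2"
    using rels(4-6) sym[of 1 0] sym[of 2 1] sym[of 2 0] by (simp_all add: eq_neg_iff_add_eq_0 algebra_simps)
  note ent = rels(1-3) diag zero[OF rels(7)] zero[OF rels(8)] zero[OF rels(9)] zero[OF rels(10)]
    zero[OF rels(11)] zero[OF rels(12)] opp[OF rels(13)] opp[OF rels(14)] opp[OF rels(15)]
  have "transpose S = S" by (simp add: S_def mat3_eq_iff transpose_nth)
  moreover have "bil B x x = net_form S x" for x
    unfolding bil_def matrix_vector_mult_def
    by (simp add: sum_6_from_0 net_form_def S_def trace_def sum_3_from_0 matrix_mult_3_nth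
      transpose_nth cof3_def sym_mat_def ent sym[of 1 0] sym[of 2 0] sym[of 3 0] sym[of 4 0]
      sym[of 5 0] sym[of 2 1] sym[of 3 1] sym[of 4 1] sym[of 5 1] sym[of 3 2] sym[of 4 2] sym[of 5 2]
      sym[of 4 3] sym[of 5 3] sym[of 5 4])
      (simp add: algebra_simps)
  ultimately show ?thesis using that by blast
qed

section \<open>Diagonalisation of ternary forms\<close>

definition congruent3 :: "'a::field^3^3 \<Rightarrow> 'a^3^3 \<Rightarrow> bool" where
  "congruent3 S T \<longleftrightarrow> (\<exists>k. invertible k \<and> transpose k ** S ** k = T)"

lemma congruent3_trans:
  assumes "congruent3 S T" "congruent3 T U" shows "congruent3 S U"
proof -
  obtain k l where "invertible k" "transpose k ** S ** k = T" "invertible l" "transpose l ** T ** l = U"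
    using assms by (auto simp: congruent3_def)
  then have "invertible (k ** l)" "transpose (k ** l) ** S ** (k ** l) = U"
    by (auto simp: invertible_mult matrix_transpose_mul matrix_mul_assoc)
  then show ?thesis by (auto simp: congruent3_def)
qed

lemma congruent3I:
  "det k \<noteq> 0 \<Longrightarrow> transpose k ** S ** k = T \<Longrightarrow> congruent3 S T"
  by (auto simp: congruent3_def invertible_det_nz)

text \<open>Complete the square if \<open>p\<close> or \<open>r\<close> is nonzero. Otherwise the
  block is zero or a hyperbolic plane, diagonalised by the sum and difference of its basis
  vectors.\<close>

lemma congruent3_diag_block:
  fixes p q r s :: "'a::field"
  assumes two: "(2::'a) \<noteq> 0"
  shows "\<exists>p' r'. congruent3 (mat3 s 0 0 0 p q 0 q r) (diag3 s p' r')"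
proof -
  consider "p \<noteq> 0" | "r \<noteq> 0" | "p = 0" "r = 0" "q = 0" | "p = 0" "r = 0" "q \<noteq> 0" by blast
  then show ?thesis
  proof cases
    case 1
    then have "congruent3 (mat3 s 0 0 0 p q 0 q r) (diag3 s p (r - q * q / p))"
      by (intro congruent3I[of "mat3 1 0 0 0 1 (- q / p) 0 0 1"])
        (simp_all add: det3 cof3_def mat3_eq_iff matrix_mult_3_nth transpose_nth field_simps)
    then show ?thesis by blast
  next
    case 2
    then have "congruent3 (mat3 s 0 0 0 p q 0 q r) (diag3 s (p - q * q / r) r)"
      by (intro congruent3I[of "mat3 1 0 0 0 1 0 0 (- q / r) 1"])
        (simp_all add: det3 cof3_def mat3_eq_iff matrix_mult_3_nth transpose_nth field_simps)
    then show ?thesis by blast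
  next
    case 3
    then have "congruent3 (mat3 s 0 0 0 p q 0 q r) (diag3 s 0 0)"
      by (intro congruent3I[of "mat3 1 0 0 0 1 0 0 0 1"])
        (simp_all add: det3 cof3_def mat3_eq_iff matrix_mult_3_nth transpose_nth)
    then show ?thesis by blast
  next
    case 4
    \<comment> \<open>This is the determinant of the base change below.\<close>
    have "- 1 - 1 \<noteq> (0::'a)" using two by (metis add_uminus_conv_diff minus_add_distrib neg_0_equal_iff_equal one_add_one)
    with 4 have "congruent3 (mat3 s 0 0 0 p q 0 q r) (diag3 s (2 * q) (- 2 * q))"
      by (intro congruent3I[of "mat3 1 0 0 0 1 1 0 1 (- 1)"])
        (simp_all add: det3 cof3_def mat3_eq_iff matrix_mult_3_nth transpose_nth)
    then show ?thesis by blast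
  qed
qed

text \<open>One Gram-Schmidt step splits off the first basis vector, and the remaining block is
  diagonalised separately.\<close>

lemma congruent3_diag_nonzero_corner:
  fixes S :: "'a::field^3^3"
  assumes two: "(2::'a) \<noteq> 0" and S: "transpose S = S" and nz: "S$0$0 \<noteq> 0"
  shows "\<exists>p q r. congruent3 S (diag3 p q r)"
proof -
  have "S $ i $ j = S $ j $ i" for i j using S by (metis transpose_nth)
  note sym = this[of 1 0] this[of 2 0] this[of 2 1]
  have "congruent3 S (mat3 (S$0$0) 0 0
      0 (S$1$1 - S$0$1 * S$0$1 / S$0$0) (S$1$2 - S$0$1 * S$0$2 / S$0$0)
      0 (S$1$2 - S$0$1 * S$0$2 / S$0$0) (S$2$2 - S$0$2 * S$0$2 / S$0$0))"
    using nz by (intro congruent3I[of "mat3 1 (- S$0$1 / S$0$0) (- S$0$2 / S$0$0) 0 1 0 0 0 1"])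
        (simp_all add: det3 cof3_def mat3_eq_iff matrix_mult_3_nth transpose_nth sym field_simps)
  then show ?thesis using congruent3_diag_block[OF two] congruent3_trans by blast
qed

lemma congruent3_diag:
  fixes S :: "'a::field^3^3"
  assumes two: "(2::'a) \<noteq> 0" and S: "transpose S = S"
  shows "\<exists>p q r. congruent3 S (diag3 p q r)"
proof -
  have "S $ i $ j = S $ j $ i" for i j using S by (metis transpose_nth)
  note sym = this[of 1 0] this[of 2 0] this[of 2 1]
  \<comment> \<open>It suffices to find a vector on which \<open>S\<close> does not vanish and use
    it as the first column of \<open>k\<close>. The cases try basis vectors, then sums of them,
    where twice an off-diagonal entry remains.\<close>
  have *: ?thesis if "det k \<noteq> 0" "(transpose k ** S ** k) $ 0 $ 0 \<noteq> 0" for k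
    using congruent3_diag_nonzero_corner[OF two transpose_congruence[OF S] that(2)]
      congruent3I[OF that(1) refl] congruent3_trans by blast
  note simps = det3 cof3_def matrix_mult_3_nth transpose_nth sym
  consider "S$0$0 \<noteq> 0" | "S$1$1 \<noteq> 0" | "S$2$2 \<noteq> 0"
    | "S$0$0 = 0" "S$1$1 = 0" "S$2$2 = 0" "S$0$1 \<noteq> 0"
    | "S$0$0 = 0" "S$1$1 = 0" "S$2$2 = 0" "S$0$2 \<noteq> 0"
    | "S$0$0 = 0" "S$1$1 = 0" "S$2$2 = 0" "S$0$1 = 0" "S$0$2 = 0" "S$1$2 \<noteq> 0"
    | "S$0$0 = 0" "S$1$1 = 0" "S$2$2 = 0" "S$0$1 = 0" "S$0$2 = 0" "S$1$2 = 0" by blast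
  then show ?thesis
  proof cases
    case 1 then show ?thesis using congruent3_diag_nonzero_corner[OF two S] by blast
  next
    case 2 then show ?thesis by (intro *[of "mat3 0 1 0 1 0 0 0 0 1"]) (simp_all add: simps)
  next
    case 3 then show ?thesis by (intro *[of "mat3 0 0 1 0 1 0 1 0 0"]) (simp_all add: simps)
  next
    case 4 then show ?thesis using two
      by (intro *[of "mat3 1 0 0 1 1 0 0 0 1"]) (simp_all add: simps flip: mult_2)
  next
    case 5 then show ?thesis using two
      by (intro *[of "mat3 1 0 0 0 1 0 1 0 1"]) (simp_all add: simps flip: mult_2)
  next
    case 6 then show ?thesis using two
      by (intro *[of "mat3 1 0 0 1 1 0 1 0 1"]) (simp_all add: simps flip: mult_2)
  next
    case 7
    then have "S = diag3 0 0 0" by (simp add: mat3_eq_iff sym)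
    then have "congruent3 S (diag3 0 0 0)"
      by (intro congruent3I[of "mat3 1 0 0 0 1 0 0 0 1"]) (simp_all add: simps mat3_eq_iff)
    then show ?thesis by blast
  qed
qed

section \<open>The normal form\<close>

lemma transpose_qab_mat: "transpose (qab_mat a b) = qab_mat a b"
  by (simp add: vec_eq_iff forall_6_from_0 transpose_nth qab_mat_def)

lemma qab_mat_vector:
  "(qab_mat a b *v x) $ 0 = x$5 / 2" "(qab_mat a b *v x) $ 1 = - x$1"
  "(qab_mat a b *v x) $ 2 = - (a * x$2)" "(qab_mat a b *v x) $ 3 = - (b * x$3)"
  "(qab_mat a b *v x) $ 4 = - (a * b * x$4)" "(qab_mat a b *v x) $ 5 = x$0 / 2"
  by (simp_all add: qab_mat_def matrix_vector_mult_def sum_6_from_0)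

lemma bil_qab_mat:
  "bil (qab_mat a b) x y = (x$0 * y$5 + x$5 * y$0) / 2
     - (x$1 * y$1 + a * x$2 * y$2 + b * x$3 * y$3 + a * b * x$4 * y$4)"
  by (simp add: bil_def sum_6_from_0 qab_mat_vector add_divide_distrib algebra_simps)

lemma qab_mat_nondegenerate:
  fixes a b :: "'a::field"
  assumes two: "(2::'a) \<noteq> 0" and "a \<noteq> 0" "b \<noteq> 0"
  shows "det (qab_mat a b) \<noteq> 0"
  unfolding invertible_det_nz[symmetric] invertible_iff_ker
  using assms by (simp add: vec_eq_iff forall_6_from_0 qab_mat_vector)

definition rep_mat :: "'a::field \<Rightarrow> 'a \<Rightarrow> 'a^6^6" where
  "rep_mat a b = (\<chi> i j.
     if i = 0 then (if j = 0 then 1 else if j = 2 then a else 0)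
     else if i = 5 then (if j = 1 then 1 else if j = 2 then b else 0)
     else if i = 1 \<and> j = 3 \<or> i = 2 \<and> j = 4 \<or> i = 3 \<and> j = 5 \<or> i = 4 \<and> j = 2 then 1
     else 0)"

lemma rep_mat_vector:
  "(rep_mat a b *v x) $ 0 = x$0 + a * x$2" "(rep_mat a b *v x) $ 1 = x$3"
  "(rep_mat a b *v x) $ 2 = x$4" "(rep_mat a b *v x) $ 3 = x$5"
  "(rep_mat a b *v x) $ 4 = x$2" "(rep_mat a b *v x) $ 5 = x$1 + b * x$2"
  by (simp_all add: rep_mat_def matrix_vector_mult_def sum_6_from_0)

lemma invertible_rep_mat: "invertible (rep_mat a b)"
  unfolding invertible_iff_ker by (simp add: vec_eq_iff forall_6_from_0 rep_mat_vector) auto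

lemma lin_app_rep_mat: "lin_app (rep_mat a b) ver0 = rep_ver a b"
  by (simp add: lin_app_def vec_eq_iff forall_6_from_0 sum_6_from_0 rep_mat_def rep_ver_def
      ver0_def ver_def)

lemma net_form_diag3:
  "net_form (diag3 p q r) x = p * (x$1 * x$2 - x$4 * x$4) + q * (x$0 * x$2 - x$5 * x$5) + r * (x$0 * x$1 - x$3 * x$3)"
  by (simp add: net_form_def trace_def sum_3_from_0 matrix_mult_3_nth transpose_nth cof3_def sym_mat_def)

text \<open>The product of \<open>a x2\<close> and \<open>b x2\<close> from the hyperbolic pair
  cancels the \<open>ab\<close> term, leaving the three minors of
  \<open>net_form_diag3\<close>.\<close>

lemma bil_qab_mat_rep_mat:
  fixes a b :: "'a::field"
  assumes "(2::'a) \<noteq> 0"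
  shows "bil (qab_mat a b) (rep_mat a b *v x) (rep_mat a b *v x) = net_form (diag3 a b 1) x"
  using assms by (simp add: bil_qab_mat net_form_diag3 rep_mat_vector field_simps)

lemma qform_qab_mat_rep_ver:
  fixes a b :: "'a::field"
  assumes two: "(2::'a) \<noteq> 0"
  shows "qform (qab_mat a b) (rep_ver a b) = 0"
proof -
  \<comment> \<open>The halves from the symmetric matrix sit inside \<open>Cst\<close> and must be
    recombined there.\<close>
  have "Cst (1/2) + Cst (1/2) = (1 :: 'a tripoly)" using two by (simp flip: Cst_add)
  then have *: "Cst (1/2) * z + Cst (1/2) * z = z" for z :: "'a tripoly"
    by (metis distrib_right mult_1)
  have "qform (qab_mat a b) (rep_ver a b) =
    (Cst (1/2) * (varU^2 + Cst a * varW^2) * (varV^2 + Cst b * varW^2)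
     + Cst (1/2) * (varV^2 + Cst b * varW^2) * (varU^2 + Cst a * varW^2)) -
    (varU * varV * (varU * varV) + Cst a * (varV * varW) * (varV * varW) + Cst b * (varU * varW) * (varU * varW)
      + Cst a * Cst b * varW^2 * varW^2)"
    by (simp add: qform_def sum_6_from_0 qab_mat_def rep_ver_def Cst_uminus Cst_mult algebra_simps)
  also have "\<dots> = 0"
    using *[of "(varU^2 + Cst a * varW^2) * (varV^2 + Cst b * varW^2)"]
    by (simp add: power2_eq_square algebra_simps)
  finally show ?thesis .
qed

text \<open>Pulled back along \<open>G\<close>, the quadric is a \<open>net_form\<close>. Its
  coefficient matrix is diagonalised, and nondegeneracy of \<open>A\<close> allows scaling the last
  entry to 1.\<close>

lemma quadric_through_Veronese:
  fixes A G :: "'a::field^6^6"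
  assumes two: "(2::'a) \<noteq> 0" and A: "transpose A = A" "det A \<noteq> 0"
    and G: "invertible G" "qform A (lin_app G ver0) = 0"
  obtains h a b c where "invertible h" "a \<noteq> 0" "b \<noteq> 0" "c \<noteq> 0"
    "\<And>x. bil A (G *v (sym_square h *v x)) (G *v (sym_square h *v x)) = c * net_form (diag3 a b 1) x"
proof -
  have "qform (transpose G ** A ** G) ver0 = 0" using G(2) by (simp add: qform_lin_app)
  then obtain S where S: "transpose S = S"
    "\<And>x. bil (transpose G ** A ** G) x x = net_form S x"
    using net_form_if_qform_ver0[OF _ transpose_congruence[OF A(1)] two] by blast
  obtain k p q r where k: "invertible k" "transpose k ** S ** k = diag3 p q r"
    using congruent3_diag[OF two S(1)] by (auto simp: congruent3_def)
  define h where "h = cof3 k"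
  have h: "invertible h" using k(1) by (simp add: h_def invertible_cof3)
  define M where "M = G ** sym_square h"
  have M: "invertible M" using G(1) h by (simp add: M_def invertible_mult invertible_sym_square)
  have Mx: "bil A (M *v x) (M *v x) = (det k)\<^sup>2 * net_form (diag3 p q r) x" for x
    using S(2)[of "sym_square h *v x"] net_form_sym_square_cof3[OF k(2), of x]
    by (simp add: bil_congruence M_def h_def flip: matrix_vector_mul_assoc)
  \<comment> \<open>If the form were additive in direction \<open>x\<close>, then \<open>x\<close>
    would be orthogonal to everything.\<close>
  have ker: "\<exists>y. net_form (diag3 p q r) (x + y) \<noteq> net_form (diag3 p q r) x + net_form (diag3 p q r) y"
    if "x \<noteq> 0" for x
  proof (rule ccontr)
    assume "\<not> ?thesis"
    then have H: "net_form (diag3 p q r) (x + y) = net_form (diag3 p q r) x + net_form (diag3 p q r) y" for y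
      by blast
    have "bil A (M *v y) (M *v x) = 0" for y
    proof -
      have "bil A (M *v x) (M *v y) = 0"
        unfolding bil_polarize[OF two A(1), of "M *v x" "M *v y"]
        by (simp add: Mx H distrib_left flip: matrix_vector_right_distrib)
      then show ?thesis by (simp add: bil_sym[OF A(1), of "M *v y"])
    qed
    then have "bil (transpose M ** A ** M) y x = 0" for y by (simp add: bil_congruence)
    moreover have "invertible (transpose M ** A ** M)"
      using M A(2) by (simp add: invertible_det_nz det_mul det_transpose)
    ultimately show False using bil_nondegenerate that by blast
  qed
  \<comment> \<open>Coordinates 4, 5 and 3 occur only in the terms with \<open>p\<close>,
    \<open>q\<close> and \<open>r\<close> respectively, so a zero coefficient would put that axis in
    the radical.\<close>
  have ax: "axis i (1::'a) \<noteq> 0" for i :: 6 by (simp add: axis_eq_0_iff)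
  have "p \<noteq> 0" using ker[OF ax[of 4]] by (auto simp: net_form_diag3 axis_def algebra_simps)
  moreover have "q \<noteq> 0" using ker[OF ax[of 5]] by (auto simp: net_form_diag3 axis_def algebra_simps)
  moreover have "r \<noteq> 0" using ker[OF ax[of 3]] by (auto simp: net_form_diag3 axis_def algebra_simps)
  moreover have "det k \<noteq> 0" using k(1) by (simp add: invertible_det_nz)
  moreover have "net_form (diag3 p q r) x = r * net_form (diag3 (p / r) (q / r) 1) x" for x
    using \<open>r \<noteq> 0\<close> by (simp add: net_form_diag3 distrib_left)
  then have "bil A (G *v (sym_square h *v x)) (G *v (sym_square h *v x))
      = (det k)\<^sup>2 * r * net_form (diag3 (p / r) (q / r) 1) x" for x
    using Mx[of x] by (simp add: M_def flip: matrix_vector_mul_assoc)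
  ultimately show ?thesis using that[of h "p / r" "q / r" "(det k)\<^sup>2 * r"] h by simp
qed

section \<open>Similarity of the normal forms\<close>

text \<open>With \<open>p = (1,0,0,0,0,1)\<close> and \<open>n = (1,0,0,0,0,-1)\<close>, products of reflections move the images of \<open>p\<close> and \<open>n\<close>
  back to \<open>p\<close> and \<open>n\<close>, so that the hyperbolic plane cancels.\<close>

lemma hyperbolic_cancellation:
  fixes a b a' b' c :: "'a::field" and P :: "'a^6^6"
  assumes two: "(2::'a) \<noteq> 0" and c: "c \<noteq> 0"
    and P: "\<And>x y. bil (qab_mat a b) (P *v x) (P *v y) = c * bil (qab_mat a' b') x y"
  obtains M :: "'a^6^6" where "\<And>i. i \<in> {1,2,3,4} \<Longrightarrow> (M *v axis i 1) $ 0 = 0"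
    "\<And>i. i \<in> {1,2,3,4} \<Longrightarrow> (M *v axis i 1) $ 5 = 0"
    "\<And>i j. i \<in> {1,2,3,4} \<Longrightarrow> j \<in> {1,2,3,4} \<Longrightarrow>
      bil (qab_mat a b) (M *v axis i 1) (M *v axis j 1) = c * qab_mat a' b' $ i $ j"
proof -
  let ?B = "bil (qab_mat a b)"
  note sym = transpose_qab_mat[of a b]
  define p n :: "'a^6" where "p = axis 0 1 + axis 5 1" and "n = axis 0 1 - axis 5 1"
  \<comment> \<open>The entry \<open>1/c\<close> absorbs the similarity factor, so the images under
    \<open>P\<close> have norms 1 and -1, as \<open>p\<close> and \<open>n\<close> do.\<close>
  define p' n' :: "'a^6" where "p' = axis 0 (1/c) + axis 5 (1::'a)" and "n' = axis 0 (1/c) - axis 5 (1::'a)"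
  note defs = p_def n_def p'_def n'_def axis_def
  have 1: "?B (P *v p') (P *v p') = 1" "?B (P *v n') (P *v n') = - 1" "?B (P *v p') (P *v n') = 0"
    "?B p p = 1" "?B n n = - 1" "?B p n = 0"
    using two c unfolding P unfolding bil_qab_mat by (simp_all add: defs)
  have perp: "?B (P *v p') (P *v axis i 1) = 0" "?B (P *v n') (P *v axis i 1) = 0"
    if "i \<in> {1,2,3,4}" for i
    using that unfolding P unfolding bil_qab_mat by (auto simp: defs)
  obtain M where M: "M *v (P *v p') = p" "\<And>u w. ?B (M *v u) (M *v w) = ?B u w"
    using isometry_moving_vector[OF two sym, of "P *v p'" p] 1 by auto
  let ?n = "M *v (P *v n')"
  have 2: "?B ?n ?n = - 1" "?B ?n p = 0" "?B n p = 0"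
    using 1 M(2)[of "P *v n'" "P *v n'"] M(2)[of "P *v n'" "P *v p'"]
    by (simp_all add: M(1) bil_sym[OF sym, of n p] bil_sym[OF sym, of "P *v n'" "P *v p'"])
  \<comment> \<open>Both \<open>?n\<close> and \<open>n\<close> are orthogonal to \<open>p\<close>,
    so the second isometry leaves \<open>p\<close> in place.\<close>
  obtain N where N: "N *v ?n = n" "\<And>u w. ?B (N *v u) (N *v w) = ?B u w" "N *v p = p"
    using isometry_moving_vector[OF two sym, of ?n n] 1 2 by auto
  define L where "L = N ** M ** P"
  have L: "L *v x = N *v (M *v (P *v x))" for x
    by (simp add: L_def flip: matrix_vector_mul_assoc)
  have "(L *v axis i 1) $ 0 = 0 \<and> (L *v axis i 1) $ 5 = 0" if "i \<in> {1,2,3,4}" for i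
  proof -
    let ?v = "L *v axis i 1"
    have "?B p ?v = ?B (P *v p') (P *v axis i 1)" "?B n ?v = ?B (P *v n') (P *v axis i 1)"
      using N(2)[of p "M *v (P *v axis i 1)"] M(2)[of "P *v p'" "P *v axis i 1"]
        N(2)[of ?n "M *v (P *v axis i 1)"] M(2)[of "P *v n'" "P *v axis i 1"]
      by (simp_all add: L N M)
    then have "?B p ?v = 0" "?B n ?v = 0" using perp[OF that] by simp_all
    moreover have "?B p ?v = (?v $ 5 + ?v $ 0) / 2" "?B n ?v = (?v $ 5 - ?v $ 0) / 2"
      by (simp_all add: bil_qab_mat defs)
    ultimately have "?v $ 5 + ?v $ 0 = 0" "?v $ 5 = ?v $ 0" using two by simp_all
    then show ?thesis using two by (simp flip: mult_2)
  qed
  moreover have "?B (L *v axis i 1) (L *v axis j 1) = c * qab_mat a' b' $ i $ j" for i j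
    by (simp add: L N M P bil_axis)
  ultimately show ?thesis using that by blast
qed

text \<open>The quaternion norm form \<open>\<langle>1, a, b, ab\<rangle>\<close>, and the components along \<open>i, j, k\<close> of the quaternion
  product of the conjugate of \<open>x\<close> with \<open>t\<close>, where \<open>i\<^sup>2 = -a\<close>, \<open>j\<^sup>2 = -b\<close>; both live on coordinates 1 to 4.\<close>

definition quat_form :: "'a::field \<Rightarrow> 'a \<Rightarrow> 'a^6 \<Rightarrow> 'a^6 \<Rightarrow> 'a" where
  "quat_form a b x t = x$1 * t$1 + a * x$2 * t$2 + b * x$3 * t$3 + a * b * x$4 * t$4"

definition quat_i :: "'a::field \<Rightarrow> 'a \<Rightarrow> 'a^6 \<Rightarrow> 'a^6 \<Rightarrow> 'a" where
  "quat_i a b x t = x$1 * t$2 - x$2 * t$1 - b * x$3 * t$4 + b * x$4 * t$3"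

definition quat_j :: "'a::field \<Rightarrow> 'a \<Rightarrow> 'a^6 \<Rightarrow> 'a^6 \<Rightarrow> 'a" where
  "quat_j a b x t = x$1 * t$3 - x$3 * t$1 - a * x$4 * t$2 + a * x$2 * t$4"

definition quat_k :: "'a::field^6 \<Rightarrow> 'a^6 \<Rightarrow> 'a" where
  "quat_k x t = x$1 * t$4 - x$4 * t$1 - x$2 * t$3 + x$3 * t$2"

text \<open>Polarised multiplicativity of the quaternion norm: \<open>quat_form a b x s\<close> is
  the real part of the conjugate of \<open>x\<close> times \<open>s\<close>.\<close>

lemma quat_form_multiplicative:
  "quat_form a b x s * quat_form a b x t + a * (quat_i a b x s * quat_i a b x t)
     + b * (quat_j a b x s * quat_j a b x t) + a * b * (quat_k x s * quat_k x t)
   = quat_form a b x x * quat_form a b s t"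
  unfolding quat_form_def quat_i_def quat_j_def quat_k_def by algebra

text \<open>Multiplication by the conjugate of \<open>t 1\<close> scales norms by \<open>c\<close>
  and maps the orthogonal complement of \<open>t 1\<close> to pure quaternions. This makes the pure
  parts similar with factor \<open>c * c\<close>.\<close>

lemma similar_quadrics_similar_ternary_forms:
  fixes a b a' b' c :: "'a::field" and P :: "'a^6^6"
  assumes two: "(2::'a) \<noteq> 0" and nz: "a \<noteq> 0" "b \<noteq> 0" "a' \<noteq> 0" "b' \<noteq> 0" "c \<noteq> 0"
    and P: "\<And>x y. bil (qab_mat a b) (P *v x) (P *v y) = c * bil (qab_mat a' b') x y"
  obtains h e where "invertible h" "e \<noteq> 0"
    "transpose h ** diag3 a b 1 ** h = mat e ** diag3 a' b' 1"
proof -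
  obtain M :: "'a^6^6" where M: "\<And>i. i \<in> {1,2,3,4} \<Longrightarrow> (M *v axis i 1) $ 0 = 0"
    "\<And>i. i \<in> {1,2,3,4} \<Longrightarrow> (M *v axis i 1) $ 5 = 0"
    "\<And>i j. i \<in> {1,2,3,4} \<Longrightarrow> j \<in> {1,2,3,4} \<Longrightarrow>
      bil (qab_mat a b) (M *v axis i 1) (M *v axis j 1) = c * qab_mat a' b' $ i $ j"
    using hyperbolic_cancellation[OF two nz(5) P] by blast
  define t where "t i = M *v axis i 1" for i
  have q: "quat_form a b (t i) (t j) = - (c * qab_mat a' b' $ i $ j)"
    if "i \<in> {1,2,3,4}" "j \<in> {1,2,3,4}" for i j
  proof -
    have "bil (qab_mat a b) (t i) (t j) = - quat_form a b (t i) (t j)"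
      using M(1)[OF that(1)] M(2)[OF that(1)] by (simp add: bil_qab_mat quat_form_def t_def)
    then show ?thesis using M(3)[OF that] unfolding t_def by (metis minus_minus)
  qed
  define I J K where "I = (\<lambda>i. quat_i a b (t 1) (t i))" and "J = (\<lambda>i. quat_j a b (t 1) (t i))"
    and "K = (\<lambda>i. quat_k (t 1) (t i))"
  have gram: "a * (I i * I j) + b * (J i * J j) + a * b * (K i * K j) = - (c * c * qab_mat a' b' $ i $ j)"
    if "i \<in> {2,3,4}" "j \<in> {2,3,4}" for i j
  proof -
    have "quat_form a b (t 1) (t i) = 0" "quat_form a b (t 1) (t 1) = c"
      "quat_form a b (t i) (t j) = - (c * qab_mat a' b' $ i $ j)"
      using that q[of 1 i] q[of 1 1] q[of i j] by (auto simp: qab_mat_def)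
    then show ?thesis using quat_form_multiplicative[of a b "t 1" "t i" "t j"]
      by (simp add: I_def J_def K_def)
  qed
  \<comment> \<open>The row factors \<open>b\<close>, \<open>a\<close>, \<open>ab\<close> and the
    order \<open>J\<close>, \<open>I\<close>, \<open>K\<close> turn the form with coefficients
    \<open>a\<close>, \<open>b\<close>, \<open>ab\<close> into \<open>diag3 a b 1\<close> up to the
    factor \<open>ab\<close>; the columns do the same for \<open>a'\<close> and
    \<open>b'\<close>.\<close>
  define h where "h = mat3 (b * a' * J 3) (b * b' * J 2) (b * J 4)
    (a * a' * I 3) (a * b' * I 2) (a * I 4)
    (a * b * a' * K 3) (a * b * b' * K 2) (a * b * K 4)"
  define e where "e = a * b * c * c * a' * b'"
  have ent: "(b * x * J i) * a * (b * y * J j) + (a * x * I i) * b * (a * y * I j)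
      + (a * b * x * K i) * (a * b * y * K j) = a * b * x * y * - (c * c * qab_mat a' b' $ i $ j)"
    if "i \<in> {2,3,4}" "j \<in> {2,3,4}" for i j x y
    unfolding gram[OF that, symmetric] by (simp add: algebra_simps)
  have "transpose h ** diag3 a b 1 ** h = mat e ** diag3 a' b' 1"
    using ent[of 3 3 a' a'] ent[of 3 2 a' b'] ent[of 3 4 a' 1]
      ent[of 2 3 b' a'] ent[of 2 2 b' b'] ent[of 2 4 b' 1]
      ent[of 4 3 1 a'] ent[of 4 2 1 b'] ent[of 4 4 1 1]
    by (simp add: mat3_eq_iff matrix_mult_3_nth transpose_nth mat_def h_def e_def qab_mat_def mult_ac)
  moreover have "e \<noteq> 0" using nz by (simp add: e_def)
  moreover have "invertible h"
  proof -
    have "det (transpose h ** diag3 a b 1 ** h) = e * e * e * (a' * b')"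
      unfolding calculation(1) by (simp add: det3 cof3_def matrix_mult_3_nth mat_def mult_ac)
    then show ?thesis using \<open>e \<noteq> 0\<close> nz by (auto simp: det_mul invertible_det_nz)
  qed
  ultimately show ?thesis using that by blast
qed

section \<open>Normal form of the quadric and uniqueness of its Veronese surface\<close>

lemma invertible_inverse_obtain:
  fixes M :: "'a::field^'n^'n"
  assumes "invertible M"
  obtains N where "invertible N" "M ** N = mat 1" "N ** M = mat 1"
proof -
  obtain N where "M ** N = mat 1" "N ** M = mat 1" using assms unfolding invertible_def by blast
  then show ?thesis using that[of N] unfolding invertible_def by blast
qed

lemma Veronese_quadric_normal_form:
  fixes A G :: "'a::field^6^6"
  assumes two: "(2::'a) \<noteq> 0" and A: "transpose A = A" "det A \<noteq> 0"
    and G: "invertible G" "qform A (lin_app G ver0) = 0"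
  obtains a b P l where "a \<noteq> 0" "b \<noteq> 0" "l \<noteq> 0" "invertible P"
    "transpose P ** A ** P = mat l ** qab_mat a b"
proof -
  obtain h a b c where h: "invertible h" "a \<noteq> 0" "b \<noteq> 0" "c \<noteq> 0"
    "\<And>x. bil A (G *v (sym_square h *v x)) (G *v (sym_square h *v x)) = c * net_form (diag3 a b 1) x"
    using quadric_through_Veronese[OF assms] by metis
  obtain R where R: "invertible R" "rep_mat a b ** R = mat 1"
    using invertible_inverse_obtain[OF invertible_rep_mat] by metis
  define P where "P = G ** sym_square h ** R"
  have "invertible P" using G h R by (simp add: P_def invertible_mult invertible_sym_square)
  moreover have "transpose P ** A ** P = mat c ** qab_mat a b"
  proof (rule sym_eq_if_quadratic_eq[OF two transpose_congruence[OF A(1)]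
        transpose_mat_mult[OF transpose_qab_mat]])
    fix x
    have "rep_mat a b *v (R *v x) = x" by (simp add: matrix_vector_mul_assoc R)
    then show "bil (transpose P ** A ** P) x x = bil (mat c ** qab_mat a b) x x"
      using h(5)[of "R *v x"] bil_qab_mat_rep_mat[OF two, of a b "R *v x"]
      by (simp add: bil_congruence bil_mat_mult P_def flip: matrix_vector_mul_assoc)
  qed
  ultimately show ?thesis using that h by blast
qed

text \<open>Reducing along \<open>G\<close> may yield other parameters \<open>a'\<close>,
  \<open>b'\<close>. The two quadrics are then similar, so the ternary forms are too, and a further
  substitution restores \<open>a\<close>, \<open>b\<close>.\<close>

lemma Veronese_surface_unique:
  fixes a b :: "'a::field" and G :: "'a^6^6"
  assumes two: "(2::'a) \<noteq> 0" and ab: "a \<noteq> 0" "b \<noteq> 0"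
    and G: "invertible G" "qform (qab_mat a b) (lin_app G ver0) = 0"
  obtains h T m where "invertible h" "invertible T"
    "transpose T ** qab_mat a b ** T = mat m ** qab_mat a b"
    "lin_app T (lin_app G (ver_h h)) = rep_ver a b"
proof -
  let ?A = "qab_mat a b"
  obtain h1 a' b' c where h1: "invertible h1" "a' \<noteq> 0" "b' \<noteq> 0" "c \<noteq> 0"
    "\<And>x. bil ?A (G *v (sym_square h1 *v x)) (G *v (sym_square h1 *v x)) = c * net_form (diag3 a' b' 1) x"
    using quadric_through_Veronese[OF two transpose_qab_mat qab_mat_nondegenerate[OF two ab] G] by metis
  define N where "N = G ** sym_square h1"
  have "invertible N" using G h1 by (simp add: N_def invertible_mult invertible_sym_square)
  then obtain N' where N': "N ** N' = mat 1" using invertible_inverse_obtain by metis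
  \<comment> \<open>This pulls the quadric of \<open>a'\<close>, \<open>b'\<close> back to a
    multiple of the given one.\<close>
  define P where "P = rep_mat a' b' ** N'"
  have "transpose P ** qab_mat a' b' ** P = mat (1 / c) ** ?A"
  proof (rule sym_eq_if_quadratic_eq[OF two transpose_congruence[OF transpose_qab_mat]
        transpose_mat_mult[OF transpose_qab_mat]])
    fix x
    have "G *v (sym_square h1 *v (N' *v x)) = x"
      using N' by (simp add: matrix_vector_mul_assoc matrix_mul_assoc N_def)
    then show "bil (transpose P ** qab_mat a' b' ** P) x x = bil (mat (1 / c) ** ?A) x x"
      using h1(4) h1(5)[of "N' *v x"] bil_qab_mat_rep_mat[OF two, of a' b' "N' *v x"]
      by (simp add: bil_congruence bil_mat_mult P_def flip: matrix_vector_mul_assoc)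
  qed
  then have "bil (qab_mat a' b') (P *v x) (P *v y) = (1 / c) * bil ?A x y" for x y
    by (metis bil_congruence bil_mat_mult)
  moreover have "1 / c \<noteq> 0" using h1 by simp
  ultimately obtain k e where k: "invertible k" "e \<noteq> 0"
    "transpose k ** diag3 a' b' 1 ** k = mat e ** diag3 a b 1"
    using similar_quadrics_similar_ternary_forms[OF two h1(2,3) ab] by metis
  \<comment> \<open>By \<open>net_form_sym_square_cof3\<close>, the factor \<open>cof3 k\<close>
    changes \<open>diag3 a' b' 1\<close> to a multiple of \<open>diag3 a b 1\<close>.\<close>
  define h where "h = h1 ** cof3 k"
  have h: "invertible h" using h1 k by (simp add: h_def invertible_mult invertible_cof3)
  define m where "m = c * ((det k)\<^sup>2 * e)"
  have m: "m \<noteq> 0" using h1 k by (simp add: m_def invertible_det_nz)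
  define H where "H = G ** sym_square h"
  have H: "bil ?A (H *v x) (H *v x) = m * net_form (diag3 a b 1) x" for x
    using h1(5)[of "sym_square (cof3 k) *v x"] net_form_sym_square_cof3[OF k(3), of x]
    by (simp add: H_def h_def sym_square_mult net_form_mat_mult m_def flip: matrix_vector_mul_assoc)
  have "invertible H" using G h by (simp add: H_def invertible_mult invertible_sym_square)
  then obtain H' where H': "invertible H'" "H ** H' = mat 1" "H' ** H = mat 1"
    using invertible_inverse_obtain by metis
  \<comment> \<open>Undo \<open>H\<close> to reach the standard surface, then map it to the
    representative; both maps match the quadrics up to scalars.\<close>
  define T where "T = rep_mat a b ** H'"
  have "invertible T" using H' by (simp add: T_def invertible_mult invertible_rep_mat)
  moreover have "transpose T ** ?A ** T = mat (1 / m) ** ?A"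
  proof (rule sym_eq_if_quadratic_eq[OF two transpose_congruence[OF transpose_qab_mat]
        transpose_mat_mult[OF transpose_qab_mat]])
    fix x
    have "H *v (H' *v x) = x" by (simp add: matrix_vector_mul_assoc H')
    then show "bil (transpose T ** ?A ** T) x x = bil (mat (1 / m) ** ?A) x x"
      using m H[of "H' *v x"] bil_qab_mat_rep_mat[OF two, of a b "H' *v x"]
      by (simp add: bil_congruence bil_mat_mult T_def flip: matrix_vector_mul_assoc)
  qed
  moreover have "lin_app T (lin_app G (ver_h h)) = rep_ver a b"
  proof -
    have "lin_app T (lin_app G (ver_h h)) = lin_app (rep_mat a b ** (H' ** H)) ver0"
      by (simp add: T_def H_def lin_app_mult lin_app_sym_square flip: matrix_mul_assoc)
    then show ?thesis by (simp add: H' lin_app_rep_mat)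
  qed
  ultimately show ?thesis using that h by blast
qed

text \<open>The representative surface lies on the normal form and is carried back by
  \<open>P\<close>.\<close>

lemma Veronese_on_normal_form:
  fixes A P :: "'a::field^6^6"
  assumes two: "(2::'a) \<noteq> 0" and P: "invertible P" "transpose P ** A ** P = mat l ** qab_mat a b"
  shows "\<exists>G. invertible G \<and> qform A (lin_app G ver0) = 0"
proof (intro exI conjI)
  show "invertible (P ** rep_mat a b)" using P by (simp add: invertible_mult invertible_rep_mat)
  show "qform A (lin_app (P ** rep_mat a b) ver0) = 0"
    by (simp add: lin_app_mult lin_app_rep_mat qform_lin_app P qform_mat_mult
        qform_qab_mat_rep_ver[OF two])
qed

theorem theorem8:
  fixes dummy :: "'a::field"
  assumes char: "(2::'a) \<noteq> 0"
  shows
    "(\<forall>A :: 'a^6^6. transpose A = A \<and> det A \<noteq> 0 \<longrightarrow>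
        ((\<exists>G :: 'a^6^6. invertible G \<and> qform A (lin_app G ver0) = 0) \<longleftrightarrow>
         (\<exists>(a::'a) (b::'a) (P::'a^6^6) (l::'a). a \<noteq> 0 \<and> b \<noteq> 0 \<and> l \<noteq> 0 \<and> invertible P \<and>
             transpose P ** A ** P = mat l ** qab_mat a b)))
     \<and>
     (\<forall>(a::'a) (b::'a). a \<noteq> 0 \<and> b \<noteq> 0 \<longrightarrow>
        (\<exists>G0 :: 'a^6^6. invertible G0 \<and> lin_app G0 ver0 = rep_ver a b) \<and>
        qform (qab_mat a b) (rep_ver a b) = 0 \<and>
        (\<forall>G :: 'a^6^6. invertible G \<and> qform (qab_mat a b) (lin_app G ver0) = 0 \<longrightarrow>
           (\<exists>(h::'a^3^3) (T::'a^6^6) (m::'a). invertible h \<and> invertible T \<and>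
              transpose T ** qab_mat a b ** T = mat m ** qab_mat a b \<and>
              lin_app T (lin_app G (ver_h h)) = rep_ver a b)))"
proof (intro conjI allI impI, goal_cases)
  case (1 A)
  then show ?case
    using Veronese_quadric_normal_form[OF char, of A] Veronese_on_normal_form[OF char, of _ A] by metis
next
  case (2 a b)
  then show ?case using invertible_rep_mat lin_app_rep_mat by blast
next
  case (3 a b)
  then show ?case using qform_qab_mat_rep_ver[OF char] by blast
next
  case (4 a b G)
  then show ?case using Veronese_surface_unique[OF char, of a b G] by metis
qed

end
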